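(* Let $H$ be the 3-dimensional complex $\omega$-Lie superalgebra with homogeneous basis $x_1,x_2\in H_{\bar 0}$, $y\in H_{\bar 1}$ and $[x_1,x_2]=x_1$, $[x_1,y]=y$, $[x_2,y]=[y,y]=0$, $\omega(x_1,x_2)=1$, $\omega(y,y)=0$. Write linear maps of $H$ as matrices in the ordered basis $(x_1,x_2,y)$ (the $j$-th column contains the coordinates of the image of the $j$-th basis vector). Then: (1) $\mathrm{GDer}(H)$ consists of all matrices $$d=\begin{pmatrix}a_{11}&0&0\\ a_{21}&a_{22}&b_{23}\\ b_{31}&b_{32}&a_{33}\end{pmatrix},$$ with associated maps $$d'=\begin{pmatrix}a'_{11}&0&0\\ a_{21}&a_{22}-a_{11}+a'_{11}&b_{23}\\ b_{31}&b_{32}&a_{33}-a_{11}+a'_{11}\end{pmatrix},\qquad d''=\begin{pmatrix}a_{22}+a'_{11}&a''_{12}&b_{23}\\ 0&a''_{22}&0\\ b_{32}&b''_{32}&a'_{11}+a_{33}\end{pmatrix};$$ in particular $\dim \mathrm{GDer}(H)=7$ and $\mathrm{GDer}(H)\neq\mathrm{End}(H)$. (2) $\mathrm{GDer}^{\omega}(H)$ consists of all matrices $$d=\begin{pmatrix}a_{11}&0&0\\ a_{21}&-a_{11}&0\\ b_{31}&b_{32}&a_{33}\end{pmatrix},$$ with associated maps $$d'=\begin{pmatrix}a'_{11}&0&0\\ a_{21}&-2a_{11}+a'_{11}&0\\ b_{31}&b_{32}&a_{33}-a_{11}+a'_{11}\end{pmatrix},\qquad d''=\begin{pmatrix}-a_{11}+a'_{11}&a''_{12}&0\\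 0&a''_{22}&0\\ b_{32}&b''_{32}&a'_{11}+a_{33}\end{pmatrix};$$ in particular $\dim \mathrm{GDer}^{\omega}(H)=5$ and $\mathrm{GDer}^{\omega}(H)\neq\mathrm{GDer}(H)$. (3) $\mathrm{QDer}(H)$ consists of all matrices $$d=\begin{pmatrix}a_{11}&0&0\\ a_{21}&a_{22}&b_{23}\\ b_{31}&b_{32}&a_{33}\end{pmatrix},\quad\text{with associated map}\quad d''=\begin{pmatrix}a_{11}+a_{22}&a''_{12}&b_{23}\\ 0&a''_{22}&0\\ b_{32}&b''_{32}&a_{11}+a_{33}\end{pmatrix};$$ in particular $\dim \mathrm{QDer}(H)=7$ and $\mathrm{QDer}(H)=\mathrm{GDer}(H)$. (4) $\mathrm{QDer}^{\omega}(H)$ consists of all matrices $$d=\begin{pmatrix}a_{11}&0&0\\ a_{21}&-a_{11}&0\\ b_{31}&b_{32}&a_{33}\end{pmatrix},\quad\text{with associated map}\quad d''=\begin{pmatrix}0&a''_{12}&0\\ 0&a''_{22}&0\\ b_{32}&b''_{32}&a_{11}+a_{33}\end{pmatrix};$$ in particular $\dim \mathrm{QDer}^{\omega}(H)=5$, $\mathrm{QDer}^{\omega}(H)\neq\mathrm{QDer}(H)$ and $\mathrm{QDer}^{\omega}(H)=\mathrm{GDer}^{\omega}(H)$. Here all entries denoted by letters range over $\mathbb{C}$.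
   Context: An $\omega$-Lie superalgebra over $\mathbb{C}$ is a $\mathbb{Z}_2$-graded vector space $g=g_{\bar 0}\oplus g_{\bar 1}$ with a bilinear bracket $[\cdot,\cdot]:g\times g\to g$ and a bilinear form $\omega:g\times g\to\mathbb{C}$ such that, for all $\alpha,\beta\in\mathbb{Z}_2$ and all homogeneous $x,y,z\in g$ (with $|x|\in\mathbb{Z}_2$ the degree of $x$): (1) $[g_\alpha,g_\beta]\subseteq g_{\alpha+\beta}$; (2) $[x,y]=-(-1)^{|x||y|}[y,x]$; (3) $(-1)^{|x||y|}[[y,z],x]+(-1)^{|y||z|}[[z,x],y]+(-1)^{|x||z|}[[x,y],z]=(-1)^{|x||y|}\omega(y,z)x+(-1)^{|y||z|}\omega(z,x)y+(-1)^{|x||z|}\omega(x,y)z$; (4) $\omega(g_{\bar 0},g_{\bar 1})=0$. For $H$, brackets of basis vectors not listed are determined by (2), and values of $\omega$ not listed are determined by (3) and (4): $\omega(x_2,x_1)=-1$, $\omega(x_1,x_1)=\omega(x_2,x_2)=0$, $\omega(x_i,y)=\omega(y,x_i)=0$. All conditions below are for homogeneous $x\in g$ and all $y\in g$. A homogeneous linear map $d:g\to g$ of degree $|d|$ is a generalized derivation if there are linear maps $d',d''$ homogeneous of degree $|d|$ with $d''([x,y])=[d(x),y]+(-1)^{|d||x|}[x,d'(y)]$; it is a quasiderivation if there is a linear map $d''$ homogeneous of degree $|d|$ with $d''([x,y])=[d(x),y]+(-1)^{|d||x|}[x,d(y)]$; it is compatible if $\omega(d(x),y)+(-1)^{|d||x|}\omega(x,d(y))=0$.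 $\mathrm{GDer}(g)$ and $\mathrm{QDer}(g)$ are the graded subspaces of $\mathrm{End}(g)$ spanned by homogeneous generalized derivations and quasiderivations; $\mathrm{GDer}^{\omega}(g)$ and $\mathrm{QDer}^{\omega}(g)$ are the graded subspaces spanned by the compatible homogeneous ones. For non-homogeneous $d$, "associated maps" $d',d''$ means that the even components of $(d,d',d'')$ and the odd components of $(d,d',d'')$ each satisfy the defining identity. *)

theory Defs
  imports
    "HOL-Analysis.Analysis"
    "HOL-Library.Z2"
    "HOL-Library.Function_Algebras"
begin

section \<open>Omega-Lie superalgebras\<close>

text \<open>
  The underlying vector space is the whole type \<^typ>\<open>'a\<close>; degrees are elements of the
  two-element field \<^typ>\<open>bit\<close>, so that addition of degrees is addition modulo 2.
\<close>

record 'a graded_bracket_space =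
  scl :: "complex \<Rightarrow> 'a \<Rightarrow> 'a"
  part :: "bit \<Rightarrow> 'a set"
  bracket :: "'a \<Rightarrow> 'a \<Rightarrow> 'a"
  form :: "'a \<Rightarrow> 'a \<Rightarrow> complex"

text \<open>\<open>koszul \<alpha> \<beta>\<close> is $(-1)^{\alpha\beta}$.\<close>

definition koszul :: "bit \<Rightarrow> bit \<Rightarrow> complex" where
  "koszul \<alpha> \<beta> = (if \<alpha> = 1 \<and> \<beta> = 1 then - 1 else 1)"

definition superspace :: "('a::ab_group_add, 'm) graded_bracket_space_scheme \<Rightarrow> bool" where
  "superspace g \<longleftrightarrow>
     vector_space (scl g) \<and>
     (\<forall>\<alpha>. module.subspace (scl g) (part g \<alpha>)) \<and>
     part g 0 \<inter> part g 1 = {0} \<and>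
     (\<forall>v. \<exists>u\<in>part g 0. \<exists>w\<in>part g 1. v = u + w)"

definition omega_Lie_superalgebra ::
    "('a::ab_group_add, 'm) graded_bracket_space_scheme \<Rightarrow> bool" where
  "omega_Lie_superalgebra g \<longleftrightarrow>
     superspace g \<and>
     (\<forall>x. Vector_Spaces.linear (scl g) (scl g) (\<lambda>y. bracket g x y)) \<and>
     (\<forall>y. Vector_Spaces.linear (scl g) (scl g) (\<lambda>x. bracket g x y)) \<and>
     (\<forall>x. Vector_Spaces.linear (scl g) (*) (\<lambda>y. form g x y)) \<and>
     (\<forall>y. Vector_Spaces.linear (scl g) (*) (\<lambda>x. form g x y)) \<and>
     (\<forall>\<alpha> \<beta>. \<forall>x\<in>part g \<alpha>. \<forall>y\<in>part g \<beta>. bracket g x y \<in> part g (\<alpha> + \<beta>)) \<and>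
     (\<forall>\<alpha> \<beta>. \<forall>x\<in>part g \<alpha>. \<forall>y\<in>part g \<beta>.
        bracket g x y = - scl g (koszul \<alpha> \<beta>) (bracket g y x)) \<and>
     (\<forall>\<alpha> \<beta> \<gamma>. \<forall>x\<in>part g \<alpha>. \<forall>y\<in>part g \<beta>. \<forall>z\<in>part g \<gamma>.
        scl g (koszul \<alpha> \<beta>) (bracket g (bracket g y z) x)
        + scl g (koszul \<beta> \<gamma>) (bracket g (bracket g z x) y)
        + scl g (koszul \<alpha> \<gamma>) (bracket g (bracket g x y) z)
        = scl g (koszul \<alpha> \<beta> * form g y z) x
        + scl g (koszul \<beta> \<gamma> * form g z x) y
        + scl g (koszul \<alpha> \<gamma> * form g x y) z) \<and>
     (\<forall>x\<in>part g 0. \<forall>y\<in>part g 1. form g x y = 0)"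


section \<open>Generalized derivations and quasiderivations\<close>

definition End :: "('a::ab_group_add, 'm) graded_bracket_space_scheme \<Rightarrow> ('a \<Rightarrow> 'a) set" where
  "End g = {d. Vector_Spaces.linear (scl g) (scl g) d}"

definition End_scl ::
    "('a, 'm) graded_bracket_space_scheme \<Rightarrow> complex \<Rightarrow> ('a \<Rightarrow> 'a) \<Rightarrow> ('a \<Rightarrow> 'a)" where
  "End_scl g c d = (\<lambda>x. scl g c (d x))"

definition End_part ::
    "('a::ab_group_add, 'm) graded_bracket_space_scheme \<Rightarrow> bit \<Rightarrow> ('a \<Rightarrow> 'a) set" where
  "End_part g \<delta> = {d \<in> End g. \<forall>\<beta>. \<forall>x\<in>part g \<beta>. d x \<in> part g (\<delta> + \<beta>)}"

definition hom_gder_triple ::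
    "('a::ab_group_add, 'm) graded_bracket_space_scheme \<Rightarrow> bit \<Rightarrow>
     ('a \<Rightarrow> 'a) \<Rightarrow> ('a \<Rightarrow> 'a) \<Rightarrow> ('a \<Rightarrow> 'a) \<Rightarrow> bool" where
  "hom_gder_triple g \<delta> d d' d'' \<longleftrightarrow>
     d \<in> End_part g \<delta> \<and> d' \<in> End_part g \<delta> \<and> d'' \<in> End_part g \<delta> \<and>
     (\<forall>\<beta>. \<forall>x\<in>part g \<beta>. \<forall>y.
        d'' (bracket g x y) = bracket g (d x) y + scl g (koszul \<delta> \<beta>) (bracket g x (d' y)))"

definition hom_qder_pair ::
    "('a::ab_group_add, 'm) graded_bracket_space_scheme \<Rightarrow> bit \<Rightarrow>
     ('a \<Rightarrow> 'a) \<Rightarrow> ('a \<Rightarrow> 'a) \<Rightarrow> bool" where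
  "hom_qder_pair g \<delta> d d'' \<longleftrightarrow>
     d \<in> End_part g \<delta> \<and> d'' \<in> End_part g \<delta> \<and>
     (\<forall>\<beta>. \<forall>x\<in>part g \<beta>. \<forall>y.
        d'' (bracket g x y) = bracket g (d x) y + scl g (koszul \<delta> \<beta>) (bracket g x (d y)))"

definition hom_compatible ::
    "('a::ab_group_add, 'm) graded_bracket_space_scheme \<Rightarrow> bit \<Rightarrow> ('a \<Rightarrow> 'a) \<Rightarrow> bool" where
  "hom_compatible g \<delta> d \<longleftrightarrow>
     (\<forall>\<beta>. \<forall>x\<in>part g \<beta>. \<forall>y. form g (d x) y + koszul \<delta> \<beta> * form g x (d y) = 0)"

definition GDer :: "('a::ab_group_add, 'm) graded_bracket_space_scheme \<Rightarrow> ('a \<Rightarrow> 'a) set" where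
  "GDer g = module.span (End_scl g) {d. \<exists>\<delta> d' d''. hom_gder_triple g \<delta> d d' d''}"

definition QDer :: "('a::ab_group_add, 'm) graded_bracket_space_scheme \<Rightarrow> ('a \<Rightarrow> 'a) set" where
  "QDer g = module.span (End_scl g) {d. \<exists>\<delta> d''. hom_qder_pair g \<delta> d d''}"

definition GDer_omega ::
    "('a::ab_group_add, 'm) graded_bracket_space_scheme \<Rightarrow> ('a \<Rightarrow> 'a) set" where
  "GDer_omega g = module.span (End_scl g)
     {d. \<exists>\<delta> d' d''. hom_gder_triple g \<delta> d d' d'' \<and> hom_compatible g \<delta> d}"

definition QDer_omega ::
    "('a::ab_group_add, 'm) graded_bracket_space_scheme \<Rightarrow> ('a \<Rightarrow> 'a) set" where
  "QDer_omega g = module.span (End_scl g)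
     {d. \<exists>\<delta> d''. hom_qder_pair g \<delta> d d'' \<and> hom_compatible g \<delta> d}"

text \<open>
  Associated maps of a not necessarily homogeneous \<open>d\<close>: in the next two definitions
  \<open>e \<delta>\<close>, \<open>e' \<delta>\<close>, \<open>e'' \<delta>\<close> are the (unique) components of degree \<open>\<delta>\<close>.
\<close>

definition gder_assoc ::
    "('a::ab_group_add, 'm) graded_bracket_space_scheme \<Rightarrow>
     ('a \<Rightarrow> 'a) \<Rightarrow> ('a \<Rightarrow> 'a) \<Rightarrow> ('a \<Rightarrow> 'a) \<Rightarrow> bool" where
  "gder_assoc g d d' d'' \<longleftrightarrow>
     (\<exists>e e' e''. d = e 0 + e 1 \<and> d' = e' 0 + e' 1 \<and> d'' = e'' 0 + e'' 1 \<and>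
        (\<forall>\<delta>. hom_gder_triple g \<delta> (e \<delta>) (e' \<delta>) (e'' \<delta>)))"

definition qder_assoc ::
    "('a::ab_group_add, 'm) graded_bracket_space_scheme \<Rightarrow> ('a \<Rightarrow> 'a) \<Rightarrow> ('a \<Rightarrow> 'a) \<Rightarrow> bool" where
  "qder_assoc g d d'' \<longleftrightarrow>
     (\<exists>e e''. d = e 0 + e 1 \<and> d'' = e'' 0 + e'' 1 \<and>
        (\<forall>\<delta>. hom_qder_pair g \<delta> (e \<delta>) (e'' \<delta>)))"

text \<open>Dimension of a complex subspace of the space of maps.\<close>

definition End_dim ::
    "('a::ab_group_add, 'm) graded_bracket_space_scheme \<Rightarrow> ('a \<Rightarrow> 'a) set \<Rightarrow> nat" where
  "End_dim g S = vector_space.dim (End_scl g) S"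

text \<open>
  Column \<open>j\<close> of \<open>matrix_of g b d\<close> contains the coordinates of \<open>d (b $ j)\<close> in the ordered
  basis \<open>b\<close>; entry \<open>i, j\<close> is \<open>matrix_of g b d $ i $ j\<close>, so \<open>vector [r1, r2, r3]\<close> lists rows.
\<close>

definition matrix_of ::
    "('a::ab_group_add, 'm) graded_bracket_space_scheme \<Rightarrow> 'a ^ 'n \<Rightarrow> ('a \<Rightarrow> 'a) \<Rightarrow>
     complex ^ 'n ^ 'n" where
  "matrix_of g b d =
     (\<chi> i j. module.representation (scl g) (range (($) b)) (d (b $ j)) (b $ i))"


section \<open>The algebra $H$\<close>

text \<open>
  The remaining brackets and values of the form on basis vectors follow from the axioms.
\<close>

definition is_H ::
    "('a::ab_group_add, 'm) graded_bracket_space_scheme \<Rightarrow> 'a \<Rightarrow> 'a \<Rightarrow> 'a \<Rightarrow> bool" where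
  "is_H H x1 x2 y \<longleftrightarrow>
     omega_Lie_superalgebra H \<and>
     distinct [x1, x2, y] \<and>
     \<not> module.dependent (scl H) {x1, x2, y} \<and>
     module.span (scl H) {x1, x2, y} = UNIV \<and>
     x1 \<in> part H 0 \<and> x2 \<in> part H 0 \<and> y \<in> part H 1 \<and>
     bracket H x1 x2 = x1 \<and> bracket H x1 y = y \<and>
     bracket H x2 y = 0 \<and> bracket H y y = 0 \<and>
     form H x1 x2 = 1 \<and> form H y y = 0"

text \<open>Such an algebra exists, on coordinate space.\<close>

definition H_model :: "(complex ^ 3) graded_bracket_space" where
  "H_model = \<lparr>
     scl = (*s),
     part = (\<lambda>\<alpha>. if \<alpha> = 0 then {v. v $ 3 = 0} else {v. v $ 1 = 0 \<and> v $ 2 = 0}),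
     bracket = (\<lambda>u v. vector [u $ 1 * v $ 2 - u $ 2 * v $ 1, 0, u $ 1 * v $ 3 - u $ 3 * v $ 1]),
     form = (\<lambda>u v. u $ 1 * v $ 2 - u $ 2 * v $ 1)\<rparr>"

lemma H_model_superspace: "superspace H_model"
proof -
  have "\<exists>u\<in>part H_model 0. \<exists>w\<in>part H_model 1. v = u + w" for v
    by (rule bexI[of _ "vector [v $ 1, v $ 2, 0]"], rule bexI[of _ "vector [0, 0, v $ 3]"])
       (auto simp: H_model_def vec_eq_iff forall_3)
  moreover have "module.subspace (scl H_model) (part H_model \<alpha>)" for \<alpha>
    by (auto simp: H_model_def vec.subspace_def)
  ultimately show ?thesis
    unfolding superspace_def
    by (auto simp: H_model_def vec_eq_iff forall_3 vec.vector_space_axioms)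
qed

lemma H_model_is_H: "is_H H_model (axis 1 1) (axis 2 1) (axis 3 1)"
proof -
  have vs: "vector_space ((*) :: complex \<Rightarrow> complex \<Rightarrow> complex)"
    by unfold_locales (simp_all add: algebra_simps)
  have lin: "Vector_Spaces.linear (scl H_model) (scl H_model) (\<lambda>y. bracket H_model x y)"
            "Vector_Spaces.linear (scl H_model) (scl H_model) (\<lambda>y. bracket H_model y x)"
            "Vector_Spaces.linear (scl H_model) (*) (\<lambda>y. form H_model x y)"
            "Vector_Spaces.linear (scl H_model) (*) (\<lambda>y. form H_model y x)" for x
    unfolding Vector_Spaces.linear_def module_hom_def module_hom_axioms_def H_model_def
    by (simp_all add: vec.vector_space_axioms vec.module_axioms vs
        module_iff_vector_space vec_eq_iff forall_3 algebra_simps)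
  have "omega_Lie_superalgebra H_model"
    unfolding omega_Lie_superalgebra_def
  proof (intro conjI allI H_model_superspace lin ballI)
    fix \<alpha> \<beta> \<gamma> x y z
    assume "x \<in> part H_model \<alpha>" "y \<in> part H_model \<beta>" "z \<in> part H_model \<gamma>"
    then show
      "scl H_model (koszul \<alpha> \<beta>) (bracket H_model (bracket H_model y z) x)
        + scl H_model (koszul \<beta> \<gamma>) (bracket H_model (bracket H_model z x) y)
        + scl H_model (koszul \<alpha> \<gamma>) (bracket H_model (bracket H_model x y) z)
        = scl H_model (koszul \<alpha> \<beta> * form H_model y z) x
        + scl H_model (koszul \<beta> \<gamma> * form H_model z x) y
        + scl H_model (koszul \<alpha> \<gamma> * form H_model x y) z"
      by (cases \<alpha>; cases \<beta>; cases \<gamma>)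
         (simp_all add: H_model_def koszul_def vec_eq_iff forall_3 algebra_simps)
  next
    fix \<alpha> \<beta> x y
    assume "x \<in> part H_model \<alpha>" "y \<in> part H_model \<beta>"
    then show "bracket H_model x y \<in> part H_model (\<alpha> + \<beta>)"
      and "bracket H_model x y = - scl H_model (koszul \<alpha> \<beta>) (bracket H_model y x)"
      by (cases \<alpha>; cases \<beta>;
          simp add: H_model_def koszul_def vec_eq_iff forall_3 algebra_simps)+
  qed (simp add: H_model_def)
  moreover have "{axis 1 1, axis 2 1, axis 3 (1::complex)} = (cart_basis :: (complex ^ 3) set)"
    by (auto simp: cart_basis_def) (metis exhaust_3)
  ultimately show ?thesis
    unfolding is_H_def
    by (simp add: H_model_def vec_eq_iff forall_3 independent_cart_basis axis_def)
qed

end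

(* In coordinates the bracket and the form are explicit bilinear maps, so a homogeneous triple
   is a generalized derivation exactly if its matrices satisfy a linear system in their entries.
   This system can be solved with d = d' as soon as it can be solved at all, which gives
   QDer = GDer; compatibility is again a linear condition respected by the grading. *)

theory Submission
  imports Defs
begin

section \<open>Auxiliary facts on degrees, 3 by 3 matrices and dimension\<close>

lemma all_bit: "(\<forall>b::bit. P b) \<longleftrightarrow> P 0 \<and> P 1"
  by (metis bit_not_one_iff)

text \<open>Turns a displayed matrix shape into nine equations that name its parameters, so that
  existential quantifiers over the entries are eliminated by substitution.\<close>

lemma matrix_3_eq_iff:
  "A = (vector [vector [a, b, c], vector [d, e, f], vector [g, h, i]] :: 'b::zero ^ 3 ^ 3) \<longleftrightarrow>
     A $ 1 $ 1 = a \<and> A $ 1 $ 2 = b \<and> A $ 1 $ 3 = c \<and>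
     A $ 2 $ 1 = d \<and> A $ 2 $ 2 = e \<and> A $ 2 $ 3 = f \<and>
     A $ 3 $ 1 = g \<and> A $ 3 $ 2 = h \<and> A $ 3 $ 3 = i"
  by (auto simp: vec_eq_iff forall_3)

text \<open>Coefficients are indexed by \<open>I\<close> rather than by vectors, so
  \<open>ind\<close> also rules out repetitions in the family. This suits bases indexed by matrix
  positions.\<close>

lemma (in vector_space) dim_eq_card_family:
  assumes fin: "finite I"
    and inT: "\<And>i. i \<in> I \<Longrightarrow> b i \<in> T"
    and gen: "\<And>t. t \<in> T \<Longrightarrow> \<exists>c. t = (\<Sum>i\<in>I. scale (c i) (b i))"
    and ind: "\<And>c i. (\<Sum>i\<in>I. scale (c i) (b i)) = 0 \<Longrightarrow> i \<in> I \<Longrightarrow> c i = 0"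
  shows "dim T = card I"
proof -
  have inj: "inj_on b I"
  proof (rule inj_onI, rule ccontr)
    fix i j assume ij: "i \<in> I" "j \<in> I" "b i = b j" "i \<noteq> j"
    \<comment> \<open>Coefficients 1 at \<open>i\<close> and -1 at \<open>j\<close> give
      \<open>b i - b j = 0\<close>, a nontrivial vanishing combination.\<close>
    let ?c = "\<lambda>k. (if k = i then 1 else 0) - (if k = j then 1 else (0::'a))"
    have "(\<Sum>k\<in>I. scale (?c k) (b k)) =
        (\<Sum>k\<in>I. if k = i then b k else 0) - (\<Sum>k\<in>I. if k = j then b k else 0)"
      unfolding sum_subtractf[symmetric] by (intro sum.cong) (auto simp: scale_left_diff_distrib)
    also have "\<dots> = 0" using fin ij by simp
    finally have "(\<Sum>k\<in>I. scale (?c k) (b k)) = 0" .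
    from ind[OF this ij(1)] ij show False by simp
  qed
  have "independent (b ` I)"
  proof (rule independent_if_scalars_zero)
    fix f v assume "(\<Sum>x\<in>b ` I. scale (f x) x) = 0" "v \<in> b ` I"
    then show "f v = 0"
      using ind[of "f \<circ> b"] by (auto simp: sum.reindex[OF inj])
  qed (simp add: fin)
  moreover have "T \<subseteq> span (b ` I)"
  proof
    fix t assume "t \<in> T"
    then obtain c where "t = (\<Sum>i\<in>I. scale (c i) (b i))" using gen by blast
    then show "t \<in> span (b ` I)" by (simp add: span_sum span_scale span_base)
  qed
  ultimately have "dim T = card (b ` I)"
    using inT by (intro dim_unique[of "b ` I"]) auto
  then show ?thesis by (simp add: card_image[OF inj])
qed

section \<open>Coordinates on H in the basis x1, x2, y\<close>

locale omega_H =
  fixes H :: "('a::ab_group_add) graded_bracket_space" and x1 x2 y :: 'a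
  assumes is_H: "is_H H x1 x2 y"
begin

lemma algebra: "omega_Lie_superalgebra H"
  and distinct_basis: "x1 \<noteq> x2" "x1 \<noteq> y" "x2 \<noteq> y"
  and basis_part: "x1 \<in> part H 0" "x2 \<in> part H 0" "y \<in> part H 1"
  and brackets: "bracket H x1 x2 = x1" "bracket H x1 y = y" "bracket H x2 y = 0" "bracket H y y = 0"
  and forms: "form H x1 x2 = 1" "form H y y = 0"
  using is_H by (auto simp: is_H_def)

sublocale V: vector_space "scl H"
  using algebra by (simp add: omega_Lie_superalgebra_def superspace_def)

lemma basis: "V.independent {x1, x2, y}" "V.span {x1, x2, y} = UNIV"
  using is_H by (auto simp: is_H_def)

lemma part_subspace: "V.subspace (part H \<alpha>)"
  and part_inter: "part H 0 \<inter> part H 1 = {0}"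
  using algebra by (auto simp: omega_Lie_superalgebra_def superspace_def)

text \<open>Together with its inverse \<open>of_coords\<close> this identifies H with
  \<open>complex ^ 3\<close>; identities in the abstract space become three equations between
  complex numbers.\<close>

definition coords :: "'a \<Rightarrow> complex ^ 3" where
  "coords u = (\<chi> i. V.representation {x1, x2, y} u (vector [x1, x2, y] $ i))"

definition of_coords :: "complex ^ 3 \<Rightarrow> 'a" where
  "of_coords v = scl H (v $ 1) x1 + scl H (v $ 2) x2 + scl H (v $ 3) y"

lemma coords_add [simp]: "coords (u + v) = coords u + coords v"
  and coords_scl [simp]: "coords (scl H c u) = c *s coords u"
  using basis by (simp_all add: coords_def vec_eq_iff V.representation_add V.representation_scale)

lemma coords_0 [simp]: "coords 0 = 0"
  using coords_add[of 0 0] by simp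

lemma coords_uminus [simp]: "coords (- u) = - coords u"
  using coords_add[of u "- u"] by (simp add: eq_neg_iff_add_eq_0 add.commute)

lemma coords_diff [simp]: "coords (u - v) = coords u - coords v"
  using coords_add[of u "- v"] by simp

lemma coords_basis [simp]:
  "coords x1 = vector [1, 0, 0]" "coords x2 = vector [0, 1, 0]" "coords y = vector [0, 0, 1]"
  using distinct_basis
  by (simp_all add: coords_def vec_eq_iff forall_3 V.representation_basis[OF basis(1)])

lemma of_coords_coords [simp]: "of_coords (coords u) = u"
proof -
  have "(\<Sum>b\<in>{x1, x2, y}. scl H (V.representation {x1, x2, y} u b) b) = u"
    using basis by (intro V.sum_representation_eq) auto
  then show ?thesis
    using distinct_basis by (simp add: of_coords_def coords_def add.assoc)
qed

lemma coords_of_coords [simp]: "coords (of_coords v) = v"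
  by (simp add: of_coords_def vec_eq_iff forall_3)

lemma coords_inject: "coords u = coords v \<longleftrightarrow> u = v"
  by (metis of_coords_coords)

section \<open>Bracket, form and grading in coordinates\<close>

lemma bracket_linear:
  "bracket H x (u + v) = bracket H x u + bracket H x v"
  "bracket H x (scl H c u) = scl H c (bracket H x u)"
  "bracket H (u + v) x = bracket H u x + bracket H v x"
  "bracket H (scl H c u) x = scl H c (bracket H u x)"
proof -
  have 1: "Vector_Spaces.linear (scl H) (scl H) (\<lambda>y. bracket H x y)"
   and 2: "Vector_Spaces.linear (scl H) (scl H) (\<lambda>y. bracket H y x)"
    using algebra unfolding omega_Lie_superalgebra_def by blast+
  show "bracket H x (u + v) = bracket H x u + bracket H x v"
    "bracket H x (scl H c u) = scl H c (bracket H x u)"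
    "bracket H (u + v) x = bracket H u x + bracket H v x"
    "bracket H (scl H c u) x = scl H c (bracket H u x)"
    using 1 2 by (simp_all add: Vector_Spaces.linear_def module_hom_def module_hom_axioms_def)
qed

lemma form_linear:
  "form H x (u + v) = form H x u + form H x v"
  "form H x (scl H c u) = c * form H x u"
  "form H (u + v) x = form H u x + form H v x"
  "form H (scl H c u) x = c * form H u x"
proof -
  have 1: "Vector_Spaces.linear (scl H) (*) (\<lambda>y. form H x y)"
   and 2: "Vector_Spaces.linear (scl H) (*) (\<lambda>y. form H y x)"
    using algebra unfolding omega_Lie_superalgebra_def by blast+
  show "form H x (u + v) = form H x u + form H x v"
    "form H x (scl H c u) = c * form H x u"
    "form H (u + v) x = form H u x + form H v x"
    "form H (scl H c u) x = c * form H u x"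
    using 1 2 by (simp_all add: Vector_Spaces.linear_def module_hom_def module_hom_axioms_def)
qed

lemma bracket_skew:
  "u \<in> part H \<alpha> \<Longrightarrow> v \<in> part H \<beta> \<Longrightarrow> bracket H u v = - scl H (koszul \<alpha> \<beta>) (bracket H v u)"
  using algebra unfolding omega_Lie_superalgebra_def by blast

text \<open>The sign for two even arguments is 1, so the bracket equals its own negative. Passing to
  complex coordinates allows division by 2, which the additive group alone does not.\<close>

lemma even_self_bracket: "u \<in> part H 0 \<Longrightarrow> bracket H u u = 0"
proof -
  assume "u \<in> part H 0"
  then have "coords (bracket H u u) = - coords (bracket H u u)"
    using bracket_skew[of u 0 u 0] by (simp add: koszul_def flip: coords_uminus)
  then have "coords (bracket H u u) = coords 0"
    by (simp add: vec_eq_iff)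
  then show ?thesis by (simp only: coords_inject)
qed

lemma brackets':
  "bracket H x1 x1 = 0" "bracket H x2 x2 = 0" "bracket H x2 x1 = - x1"
  "bracket H y x1 = - y" "bracket H y x2 = 0"
  using even_self_bracket basis_part bracket_skew[of x2 0 x1 0] bracket_skew[of y 1 x1 0]
    bracket_skew[of y 1 x2 0]
  by (simp_all add: koszul_def brackets)

text \<open>Bilinear expansion over pairs of basis vectors. With \<open>form_coords\<close> it shows
  that every algebra satisfying \<open>is_H\<close> has the bracket and form of
  \<open>H_model\<close>.\<close>

lemma coords_bracket [simp]:
  "coords (bracket H u v) =
     vector [coords u $ 1 * coords v $ 2 - coords u $ 2 * coords v $ 1, 0,
             coords u $ 1 * coords v $ 3 - coords u $ 3 * coords v $ 1]"
proof -
  have "coords (bracket H (of_coords a) (of_coords b)) =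
     vector [a $ 1 * b $ 2 - a $ 2 * b $ 1, 0, a $ 1 * b $ 3 - a $ 3 * b $ 1]" for a b
    by (simp add: of_coords_def bracket_linear brackets brackets' vec_eq_iff forall_3 algebra_simps)
  from this[of "coords u" "coords v"] show ?thesis by simp
qed

text \<open>
  Identity (3) with two even arguments carries no signs; on basis vectors it forces the
  values of the form that \<open>is_H\<close> leaves open.
\<close>

lemma omega_Jacobi_even:
  assumes "u \<in> part H 0" "v \<in> part H 0" "w \<in> part H \<gamma>"
  shows "bracket H (bracket H v w) u + bracket H (bracket H w u) v + bracket H (bracket H u v) w
    = scl H (form H v w) u + scl H (form H w u) v + scl H (form H u v) w"
proof -
  have "\<forall>\<alpha> \<beta> \<gamma>. \<forall>x\<in>part H \<alpha>. \<forall>y\<in>part H \<beta>. \<forall>z\<in>part H \<gamma>.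
        scl H (koszul \<alpha> \<beta>) (bracket H (bracket H y z) x)
        + scl H (koszul \<beta> \<gamma>) (bracket H (bracket H z x) y)
        + scl H (koszul \<alpha> \<gamma>) (bracket H (bracket H x y) z)
        = scl H (koszul \<alpha> \<beta> * form H y z) x
        + scl H (koszul \<beta> \<gamma> * form H z x) y
        + scl H (koszul \<alpha> \<gamma> * form H x y) z"
    using algebra unfolding omega_Lie_superalgebra_def by blast
  from this[rule_format, OF assms] show ?thesis by (simp add: koszul_def)
qed

lemma forms':
  "form H x1 x1 = 0" "form H x2 x2 = 0" "form H x2 x1 = - 1"
  "form H x1 y = 0" "form H x2 y = 0" "form H y x1 = 0" "form H y x2 = 0"
proof -
  have *: "\<forall>x\<in>part H 0. \<forall>y\<in>part H 1. form H x y = 0"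
    using algebra unfolding omega_Lie_superalgebra_def by blast
  show xy: "form H x1 y = 0" "form H x2 y = 0"
    using * basis_part by auto
  note J = omega_Jacobi_even[THEN arg_cong[where f = coords]]
  \<comment> \<open>For a triple (u, u, w) with u even, the left side of the identity vanishes by
    skew-symmetry. Taking w = u leaves 3 \<omega>(u, u) u = 0; for another basis vector w, the
    coefficient of u is \<omega>(u, w) + \<omega>(w, u).\<close>
  show x11: "form H x1 x1 = 0" and "form H x2 x2 = 0"
    using J[of x1 x1 x1] J[of x2 x2 x2] basis_part by (simp_all add: vec_eq_iff forall_3)
  show "form H x2 x1 = - 1"
    using J[of x1 x1 x2] basis_part x11
    by (simp add: vec_eq_iff forall_3 forms add_eq_0_iff)
  \<comment> \<open>Axiom (4) gives the value 0 only for an even first and odd second argument; the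
    triples (x1, x1, y) and (x2, x2, y) transfer it to the other order.\<close>
  show "form H y x1 = 0" "form H y x2 = 0"
    using J[of x1 x1 y] J[of x2 x2 y] basis_part xy
    by (simp_all add: vec_eq_iff forall_3)
qed

lemma form_coords:
  "form H u v = coords u $ 1 * coords v $ 2 - coords u $ 2 * coords v $ 1"
proof -
  have "form H (of_coords a) (of_coords b) = a $ 1 * b $ 2 - a $ 2 * b $ 1" for a b
    by (simp add: of_coords_def form_linear forms forms' algebra_simps)
  from this[of "coords u" "coords v"] show ?thesis by simp
qed

text \<open>\<open>is_H\<close> only places the basis vectors in the two parts. If u is homogeneous,
  its component of the other degree is u minus the component of its own degree, hence lies in both
  parts and is 0.\<close>

lemma part_0_iff: "u \<in> part H 0 \<longleftrightarrow> coords u $ 3 = 0"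
  and part_1_iff: "u \<in> part H 1 \<longleftrightarrow> coords u $ 1 = 0 \<and> coords u $ 2 = 0"
proof -
  let ?u0 = "scl H (coords u $ 1) x1 + scl H (coords u $ 2) x2" and ?u1 = "scl H (coords u $ 3) y"
  have u: "u = ?u0 + ?u1"
    unfolding coords_inject[symmetric] by (simp add: vec_eq_iff forall_3)
  have u0: "?u0 \<in> part H 0"
    using basis_part by (intro V.subspace_add V.subspace_scale part_subspace)
  have u1: "?u1 \<in> part H 1"
    using basis_part by (intro V.subspace_scale part_subspace)
  have c0: "coords u $ 1 = 0 \<and> coords u $ 2 = 0" if "?u0 = 0"
    using arg_cong[OF that, of coords] by (simp add: vec_eq_iff forall_3)
  have c1: "coords u $ 3 = 0" if "?u1 = 0"
    using arg_cong[OF that, of coords] by (simp add: vec_eq_iff forall_3)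
  have "u \<in> part H 0 \<Longrightarrow> ?u1 \<in> part H 0"
    using V.subspace_diff[OF part_subspace _ u0, of u] u by (metis add_diff_cancel_left')
  moreover have "u \<in> part H 1 \<Longrightarrow> ?u0 \<in> part H 1"
    using V.subspace_diff[OF part_subspace _ u1, of u] u by (metis add_diff_cancel_right')
  moreover have "coords u $ 3 = 0 \<Longrightarrow> u = ?u0" "coords u $ 1 = 0 \<and> coords u $ 2 = 0 \<Longrightarrow> u = ?u1"
    using u by auto
  ultimately show "u \<in> part H 0 \<longleftrightarrow> coords u $ 3 = 0"
    and "u \<in> part H 1 \<longleftrightarrow> coords u $ 1 = 0 \<and> coords u $ 2 = 0"
    using u0 u1 c0 c1 part_inter by (metis Int_iff singletonD)+
qed

section \<open>Linear maps as matrices, and their degree\<close>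

definition mat_of :: "('a \<Rightarrow> 'a) \<Rightarrow> complex ^ 3 ^ 3" where
  "mat_of = matrix_of H (vector [x1, x2, y])"

definition map_of_mat :: "complex ^ 3 ^ 3 \<Rightarrow> 'a \<Rightarrow> 'a" where
  "map_of_mat A u = of_coords (A *v coords u)"

lemma mat_of_nth: "mat_of d $ i $ j = coords (d (vector [x1, x2, y] $ j)) $ i"
proof -
  have "range (($) (vector [x1, x2, y] :: 'a ^ 3)) = {x1, x2, y}"
    by (simp add: UNIV_3 insert_commute)
  then show ?thesis by (simp add: mat_of_def matrix_of_def coords_def)
qed

lemma mat_of_add [simp]: "mat_of (d + e) = mat_of d + mat_of e"
  and mat_of_scl: "mat_of (End_scl H c d) $ i $ j = c * mat_of d $ i $ j"
  and mat_of_0 [simp]: "mat_of 0 = 0"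
  by (simp_all add: vec_eq_iff mat_of_nth End_scl_def)

lemma coords_End:
  assumes "d \<in> End H"
  shows "coords (d u) = mat_of d *v coords u"
proof -
  have lin: "d (a + b) = d a + d b" "d (scl H c a) = scl H c (d a)" for a b c
    using assms by (simp_all add: End_def Vector_Spaces.linear_def module_hom_def module_hom_axioms_def)
  have "coords (d (of_coords (coords u))) = mat_of d *v coords u"
    by (simp add: of_coords_def lin vec_eq_iff forall_3 mat_of_nth matrix_vector_mult_def sum_3
        mult.commute del: of_coords_coords)
  then show ?thesis by simp
qed

lemma End_subspace_closed:
  "d \<in> End H \<Longrightarrow> e \<in> End H \<Longrightarrow> d + e \<in> End H"
  "d \<in> End H \<Longrightarrow> End_scl H c d \<in> End H"
  "0 \<in> End H"
  by (auto simp: End_def Vector_Spaces.linear_def module_hom_def module_hom_axioms_def End_scl_def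
      V.scale_right_distrib mult.commute V.vector_space_axioms V.module_axioms)

lemma map_of_mat_End [simp]: "map_of_mat A \<in> End H"
proof -
  have "map_of_mat A (a + b) = map_of_mat A a + map_of_mat A b"
    "map_of_mat A (scl H c a) = scl H c (map_of_mat A a)" for a b c
    unfolding coords_inject[symmetric]
    by (simp_all add: map_of_mat_def matrix_vector_right_distrib vector_scalar_commute)
  then show ?thesis
    by (simp add: End_def Vector_Spaces.linear_def module_hom_def module_hom_axioms_def
        V.vector_space_axioms V.module_axioms)
qed

lemma mat_of_map_of_mat [simp]: "mat_of (map_of_mat A) = A"
  by (simp add: vec_eq_iff forall_3 mat_of_nth map_of_mat_def matrix_vector_mult_def sum_3)

lemma End_eqI: "d \<in> End H \<Longrightarrow> e \<in> End H \<Longrightarrow> mat_of d = mat_of e \<Longrightarrow> d = e"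
  by (rule ext) (metis coords_End coords_inject)

sublocale E: vector_space "End_scl H"
  by unfold_locales
    (auto simp: End_scl_def V.scale_right_distrib V.scale_left_distrib)

text \<open>Block shapes for dimension 2|1: block diagonal for even maps, off-diagonal for odd
  ones.\<close>

definition mat_parity :: "bit \<Rightarrow> complex ^ 3 ^ 3 \<Rightarrow> bool" where
  "mat_parity \<delta> A \<longleftrightarrow>
     (if \<delta> = 0 then A $ 1 $ 3 = 0 \<and> A $ 2 $ 3 = 0 \<and> A $ 3 $ 1 = 0 \<and> A $ 3 $ 2 = 0
      else A $ 1 $ 1 = 0 \<and> A $ 1 $ 2 = 0 \<and> A $ 2 $ 1 = 0 \<and> A $ 2 $ 2 = 0 \<and> A $ 3 $ 3 = 0)"

lemma mat_parity_simps:
  "mat_parity 0 A \<longleftrightarrow> A $ 1 $ 3 = 0 \<and> A $ 2 $ 3 = 0 \<and> A $ 3 $ 1 = 0 \<and> A $ 3 $ 2 = 0"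
  "mat_parity 1 A \<longleftrightarrow>
     A $ 1 $ 1 = 0 \<and> A $ 1 $ 2 = 0 \<and> A $ 2 $ 1 = 0 \<and> A $ 2 $ 2 = 0 \<and> A $ 3 $ 3 = 0"
  by (simp_all add: mat_parity_def)

lemma coords_End_nth:
  assumes "d \<in> End H"
  shows "coords (d u) $ i =
    mat_of d $ i $ 1 * coords u $ 1 + mat_of d $ i $ 2 * coords u $ 2 + mat_of d $ i $ 3 * coords u $ 3"
  by (simp add: coords_End[OF assms] matrix_vector_mult_def sum_3)

lemma End_part_iff: "d \<in> End_part H \<delta> \<longleftrightarrow> d \<in> End H \<and> mat_parity \<delta> (mat_of d)"
proof (cases "d \<in> End H")
  case True
  have "(\<forall>\<beta>. \<forall>x\<in>part H \<beta>. d x \<in> part H (\<delta> + \<beta>)) \<longleftrightarrow> mat_parity \<delta> (mat_of d)" (is "?L \<longleftrightarrow> ?R")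
  proof
    assume L: ?L
    have "d x1 \<in> part H \<delta>" "d x2 \<in> part H \<delta>" "d y \<in> part H (\<delta> + 1)"
      using L basis_part by (metis add.right_neutral)+
    then show ?R
      by (cases \<delta>) (simp_all add: mat_parity_simps part_0_iff part_1_iff coords_End_nth[OF True])
  next
    assume ?R
    then show ?L
      by (cases \<delta>) (simp_all add: all_bit mat_parity_simps part_0_iff part_1_iff coords_End_nth[OF True])
  qed
  then show ?thesis by (simp add: End_part_def True)
qed (simp add: End_part_def)

section \<open>Derivation identity and compatibility as linear systems\<close>

text \<open>
  The defining identity on pairs of basis vectors. The relations are linear, and no relation
  mixes entries of different degree, so the same system serves both degrees and, by
  summing components, the non-homogeneous maps.
\<close>

definition gder_relations ::
    "complex ^ 3 ^ 3 \<Rightarrow> complex ^ 3 ^ 3 \<Rightarrow> complex ^ 3 ^ 3 \<Rightarrow> bool" where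
  "gder_relations A A' A'' \<longleftrightarrow>
     A $ 1 $ 2 = 0 \<and> A $ 1 $ 3 = 0 \<and> A' $ 1 $ 2 = 0 \<and> A' $ 1 $ 3 = 0 \<and>
     A' $ 2 $ 1 = A $ 2 $ 1 \<and> A' $ 2 $ 3 = A $ 2 $ 3 \<and>
     A' $ 3 $ 1 = A $ 3 $ 1 \<and> A' $ 3 $ 2 = A $ 3 $ 2 \<and>
     A' $ 2 $ 2 = A $ 2 $ 2 - A $ 1 $ 1 + A' $ 1 $ 1 \<and>
     A' $ 3 $ 3 = A $ 3 $ 3 - A $ 1 $ 1 + A' $ 1 $ 1 \<and>
     A'' $ 1 $ 1 = A $ 2 $ 2 + A' $ 1 $ 1 \<and> A'' $ 1 $ 3 = A $ 2 $ 3 \<and>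
     A'' $ 2 $ 1 = 0 \<and> A'' $ 2 $ 3 = 0 \<and>
     A'' $ 3 $ 1 = A $ 3 $ 2 \<and> A'' $ 3 $ 3 = A' $ 1 $ 1 + A $ 3 $ 3"

text \<open>Swapped pairs of basis vectors give different equations, because \<open>d\<close> and
  \<open>d'\<close> may differ; hence all nine ordered pairs are evaluated. The pairs (x2, y) and
  (y, x2), whose bracket is 0, produce the zeros in the first rows of \<open>d\<close> and
  \<open>d'\<close>. The second column of \<open>d''\<close> stays free because all brackets lie in
  the span of x1 and y. Conversely, the relations give the identity for arbitrary homogeneous
  arguments by computing in coordinates.\<close>

lemma hom_gder_triple_iff:
  "hom_gder_triple H \<delta> d d' d'' \<longleftrightarrow>
     d \<in> End_part H \<delta> \<and> d' \<in> End_part H \<delta> \<and> d'' \<in> End_part H \<delta> \<and>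
     gder_relations (mat_of d) (mat_of d') (mat_of d'')"
proof (cases "d \<in> End_part H \<delta> \<and> d' \<in> End_part H \<delta> \<and> d'' \<in> End_part H \<delta>")
  case True
  then have E: "d \<in> End H" "d' \<in> End H" "d'' \<in> End H"
    and P: "mat_parity \<delta> (mat_of d)" "mat_parity \<delta> (mat_of d')" "mat_parity \<delta> (mat_of d'')"
    by (simp_all add: End_part_iff)
  note nth = coords_End_nth[OF E(1)] coords_End_nth[OF E(2)] coords_End_nth[OF E(3)]
  have "(\<forall>\<beta>. \<forall>x\<in>part H \<beta>. \<forall>y. d'' (bracket H x y) =
      bracket H (d x) y + scl H (koszul \<delta> \<beta>) (bracket H x (d' y)))
    \<longleftrightarrow> gder_relations (mat_of d) (mat_of d') (mat_of d'')" (is "?L \<longleftrightarrow> ?R")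
  proof
    assume ?L
    then have L: "coords (d'' (bracket H u v)) =
        coords (bracket H (d u) v + scl H (koszul \<delta> \<beta>) (bracket H u (d' v)))"
      if "u \<in> part H \<beta>" for u v \<beta>
      using that by simp
    note L1 = L[OF basis_part(1)] and L2 = L[OF basis_part(2)] and L3 = L[OF basis_part(3)]
    note L' = L1[of x1] L1[of x2] L1[of y] L2[of x1] L2[of x2] L2[of y] L3[of x1] L3[of x2] L3[of y]
    show ?R
    proof (cases \<delta>)
      case zero
      show ?thesis
        using P L' unfolding gder_relations_def zero mat_parity_simps
        by (simp add: vec_eq_iff forall_3 nth koszul_def) (auto simp: algebra_simps)
    next
      case one
      show ?thesis
        using P L' unfolding gder_relations_def one mat_parity_simps
        by (simp add: vec_eq_iff forall_3 nth koszul_def)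
    qed
  next
    assume R: ?R
    show ?L
    proof (intro allI ballI)
      fix \<beta> u v assume u: "u \<in> part H \<beta>"
      note R' = R[unfolded gder_relations_def]
      have "coords (d'' (bracket H u v)) =
        coords (bracket H (d u) v + scl H (koszul \<delta> \<beta>) (bracket H u (d' v)))"
      proof (cases \<delta>)
        case zero
        note P' = P[unfolded zero mat_parity_simps]
        show ?thesis
          using u by (cases \<beta>) (simp_all add: zero R' P' part_0_iff part_1_iff
            vec_eq_iff forall_3 nth koszul_def algebra_simps)
      next
        case one
        note P' = P[unfolded one mat_parity_simps]
        show ?thesis
          using u by (cases \<beta>) (simp_all add: one R' P' part_0_iff part_1_iff
            vec_eq_iff forall_3 nth koszul_def algebra_simps)
      qed
      then show "d'' (bracket H u v) =
        bracket H (d u) v + scl H (koszul \<delta> \<beta>) (bracket H u (d' v))"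
        by (simp only: coords_inject)
    qed
  qed
  then show ?thesis by (simp add: hom_gder_triple_def True)
qed (auto simp: hom_gder_triple_def)

lemma hom_qder_pair_eq: "hom_qder_pair H \<delta> d d'' \<longleftrightarrow> hom_gder_triple H \<delta> d d d''"
  by (auto simp: hom_qder_pair_def hom_gder_triple_def)

text \<open>The form is the standard symplectic form on the even part and has y in its radical.
  Compatibility therefore makes the even block of an even map traceless and forces an odd map to
  annihilate y.\<close>

definition compatible_relations :: "complex ^ 3 ^ 3 \<Rightarrow> bool" where
  "compatible_relations A \<longleftrightarrow> A $ 2 $ 2 = - A $ 1 $ 1 \<and> A $ 1 $ 3 = 0 \<and> A $ 2 $ 3 = 0"

lemma hom_compatible_iff:
  assumes "d \<in> End_part H \<delta>"
  shows "hom_compatible H \<delta> d \<longleftrightarrow> compatible_relations (mat_of d)"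
proof -
  from assms have E: "d \<in> End H" and P: "mat_parity \<delta> (mat_of d)"
    by (simp_all add: End_part_iff)
  note nth = coords_End_nth[OF E]
  show ?thesis
  proof
    assume "hom_compatible H \<delta> d"
    then have L: "form H (d u) v + koszul \<delta> \<beta> * form H u (d v) = 0"
      if "u \<in> part H \<beta>" for u v \<beta>
      using that by (simp add: hom_compatible_def)
    show "compatible_relations (mat_of d)"
      using P L[OF basis_part(1), of x2] L[OF basis_part(1), of y] L[OF basis_part(2), of y]
      by (cases \<delta>) (simp_all add: compatible_relations_def mat_parity_simps form_coords nth
          koszul_def add_eq_0_iff)
  next
    assume "compatible_relations (mat_of d)"
    then show "hom_compatible H \<delta> d"
      using P
      by (cases \<delta>) (simp_all add: all_bit hom_compatible_def compatible_relations_def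
          mat_parity_simps form_coords nth koszul_def part_0_iff part_1_iff algebra_simps)
  qed
qed

section \<open>Homogeneous components and associated maps\<close>

definition hom_part :: "bit \<Rightarrow> complex ^ 3 ^ 3 \<Rightarrow> complex ^ 3 ^ 3" where
  "hom_part \<delta> A =
     (if \<delta> = 0 then vector [vector [A $ 1 $ 1, A $ 1 $ 2, 0], vector [A $ 2 $ 1, A $ 2 $ 2, 0],
                         vector [0, 0, A $ 3 $ 3]]
      else vector [vector [0, 0, A $ 1 $ 3], vector [0, 0, A $ 2 $ 3],
                   vector [A $ 3 $ 1, A $ 3 $ 2, 0]])"

lemma map_of_hom_part_End_part: "map_of_mat (hom_part \<delta> A) \<in> End_part H \<delta>"
  by (cases \<delta>) (simp_all add: End_part_iff mat_parity_simps hom_part_def)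

lemma End_eq_hom_parts:
  "d \<in> End H \<Longrightarrow> d = map_of_mat (hom_part 0 (mat_of d)) + map_of_mat (hom_part 1 (mat_of d))"
  by (rule End_eqI) (auto simp: hom_part_def vec_eq_iff forall_3 intro: End_subspace_closed)

text \<open>Each equation of \<open>gder_relations\<close> involves entries from one block shape
  only, so projecting to degree \<delta> either keeps it or turns it into 0 = 0.\<close>

lemma hom_gder_triple_hom_part:
  "gder_relations A A' A'' \<Longrightarrow> hom_gder_triple H \<delta> (map_of_mat (hom_part \<delta> A))
     (map_of_mat (hom_part \<delta> A')) (map_of_mat (hom_part \<delta> A''))"
  unfolding hom_gder_triple_iff mat_of_map_of_mat
  by (auto simp: map_of_hom_part_End_part) (auto simp: gder_relations_def hom_part_def)

lemma compatible_relations_hom_part: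
  "compatible_relations A \<Longrightarrow> compatible_relations (hom_part \<delta> A)"
  by (cases \<delta>) (simp_all add: compatible_relations_def hom_part_def)

lemma gder_relations_add:
  "gder_relations A A' A'' \<Longrightarrow> gder_relations B B' B'' \<Longrightarrow> gder_relations (A + B) (A' + B') (A'' + B'')"
  by (simp add: gder_relations_def)

text \<open>Removes the grading: the systems of the two components add up to the system of the sum,
  and conversely the block projections of a solution are solutions.\<close>

lemma gder_assoc_iff:
  "gder_assoc H d d' d'' \<longleftrightarrow>
     d \<in> End H \<and> d' \<in> End H \<and> d'' \<in> End H \<and> gder_relations (mat_of d) (mat_of d') (mat_of d'')"
proof
  assume "gder_assoc H d d' d''"
  then obtain e e' e'' where "d = e 0 + e 1" "d' = e' 0 + e' 1" "d'' = e'' 0 + e'' 1"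
    "\<And>\<delta>. hom_gder_triple H \<delta> (e \<delta>) (e' \<delta>) (e'' \<delta>)"
    unfolding gder_assoc_def by blast
  then show "d \<in> End H \<and> d' \<in> End H \<and> d'' \<in> End H \<and>
      gder_relations (mat_of d) (mat_of d') (mat_of d'')"
    by (simp add: hom_gder_triple_iff End_part_iff End_subspace_closed gder_relations_add)
next
  assume R: "d \<in> End H \<and> d' \<in> End H \<and> d'' \<in> End H \<and>
      gder_relations (mat_of d) (mat_of d') (mat_of d'')"
  let ?e = "\<lambda>d \<delta>. map_of_mat (hom_part \<delta> (mat_of d))"
  show "gder_assoc H d d' d''"
    unfolding gder_assoc_def
    using R by (intro exI[of _ "?e d"] exI[of _ "?e d'"] exI[of _ "?e d''"] conjI allI
        End_eq_hom_parts hom_gder_triple_hom_part) simp_all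
qed

text \<open>\<open>gder_assoc\<close> would allow different decompositions for the two copies of
  \<open>d\<close>, while \<open>qder_assoc\<close> wants a single one. Taking the block projections
  as components gives the same decomposition for both.\<close>

lemma qder_assoc_iff: "qder_assoc H d d'' \<longleftrightarrow> gder_assoc H d d d''"
proof
  assume "gder_assoc H d d d''"
  then have R: "d \<in> End H" "d'' \<in> End H" "gder_relations (mat_of d) (mat_of d) (mat_of d'')"
    by (simp_all add: gder_assoc_iff)
  let ?e = "\<lambda>d \<delta>. map_of_mat (hom_part \<delta> (mat_of d))"
  show "qder_assoc H d d''"
    unfolding qder_assoc_def hom_qder_pair_eq
    using R by (intro exI[of _ "?e d"] exI[of _ "?e d''"] conjI allI
        End_eq_hom_parts hom_gder_triple_hom_part) simp_all
qed (auto simp: qder_assoc_def gder_assoc_def hom_qder_pair_eq)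

section \<open>The four spaces of derivations\<close>

text \<open>Invariance of the span of x2 and y: the condition that remains on \<open>A\<close> when
  \<open>A'\<close> and \<open>A''\<close> are eliminated from
  \<open>gder_relations\<close>.\<close>

definition gder_mat :: "complex ^ 3 ^ 3 \<Rightarrow> bool" where
  "gder_mat A \<longleftrightarrow> A $ 1 $ 2 = 0 \<and> A $ 1 $ 3 = 0"

lemma gder_mat_imp_relations:
  assumes "gder_mat A"
  obtains A'' where "gder_relations A A A''"
proof
  \<comment> \<open>With \<open>A' = A\<close> the equations between \<open>A\<close> and
    \<open>A'\<close> hold trivially. The first and third columns of \<open>A''\<close> are then
    forced; the free second column is set to 0.\<close>
  show "gder_relations A A (vector [vector [A $ 1 $ 1 + A $ 2 $ 2, 0, A $ 2 $ 3], vector [0, 0, 0],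
      vector [A $ 3 $ 2, 0, A $ 1 $ 1 + A $ 3 $ 3]])"
    using assms by (simp add: gder_relations_def gder_mat_def)
qed

text \<open>Common pattern of the four computations: a subspace of \<open>End H\<close> whose
  members have both homogeneous components among the generators is contained in their span, and it
  contains the span once it contains the generators.\<close>

lemma span_homogeneous_eq:
  assumes gens: "\<And>d. d \<in> S \<Longrightarrow> d \<in> End H \<and> P (mat_of d)"
    and comps: "\<And>A \<delta>. P A \<Longrightarrow> map_of_mat (hom_part \<delta> A) \<in> S"
    and sub: "E.subspace {d \<in> End H. P (mat_of d)}"
  shows "E.span S = {d \<in> End H. P (mat_of d)}"
proof
  show "E.span S \<subseteq> {d \<in> End H. P (mat_of d)}"
    using gens sub by (intro E.span_minimal) auto
  show "{d \<in> End H. P (mat_of d)} \<subseteq> E.span S"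
  proof
    fix d assume "d \<in> {d \<in> End H. P (mat_of d)}"
    then show "d \<in> E.span S"
      by (subst End_eq_hom_parts) (auto intro: E.span_add E.span_base comps)
  qed
qed

lemma subspace_gder_mat: "E.subspace {d \<in> End H. gder_mat (mat_of d)}"
  and subspace_compatible_gder_mat:
    "E.subspace {d \<in> End H. gder_mat (mat_of d) \<and> compatible_relations (mat_of d)}"
  by (auto simp: E.subspace_def End_subspace_closed gder_mat_def compatible_relations_def mat_of_scl)

lemma gder_mat_if_relations: "gder_relations A A' A'' \<Longrightarrow> gder_mat A"
  by (simp add: gder_relations_def gder_mat_def)

lemma hom_qder_pair_hom_part:
  assumes "gder_mat A"
  shows "\<exists>d''. hom_qder_pair H \<delta> (map_of_mat (hom_part \<delta> A)) d''"
  using gder_mat_imp_relations[OF assms] hom_gder_triple_hom_part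
  unfolding hom_qder_pair_eq by metis

lemma QDer_eq: "QDer H = {d \<in> End H. gder_mat (mat_of d)}"
  unfolding QDer_def
proof (rule span_homogeneous_eq)
  show "d \<in> End H \<and> gder_mat (mat_of d)" if "d \<in> {d. \<exists>\<delta> d''. hom_qder_pair H \<delta> d d''}" for d
    using that by (auto simp: hom_qder_pair_eq hom_gder_triple_iff End_part_iff
        intro: gder_mat_if_relations)
qed (use hom_qder_pair_hom_part subspace_gder_mat in blast)+

text \<open>The generators come from \<open>hom_qder_pair_hom_part\<close> as for
  \<open>QDer\<close>, since a quasiderivation is a generalized derivation with
  \<open>d' = d\<close>.\<close>

lemma GDer_eq: "GDer H = {d \<in> End H. gder_mat (mat_of d)}"
  unfolding GDer_def
proof (rule span_homogeneous_eq)
  show "d \<in> End H \<and> gder_mat (mat_of d)" if "d \<in> {d. \<exists>\<delta> d' d''. hom_gder_triple H \<delta> d d' d''}" for d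
    using that by (auto simp: hom_gder_triple_iff End_part_iff intro: gder_mat_if_relations)
qed (use hom_qder_pair_hom_part subspace_gder_mat hom_qder_pair_eq in blast)+

lemma compatible_hom_part:
  "compatible_relations A \<Longrightarrow> hom_compatible H \<delta> (map_of_mat (hom_part \<delta> A))"
  by (simp add: hom_compatible_iff map_of_hom_part_End_part compatible_relations_hom_part)

lemma QDer_omega_eq:
  "QDer_omega H = {d \<in> End H. gder_mat (mat_of d) \<and> compatible_relations (mat_of d)}"
  unfolding QDer_omega_def
proof (rule span_homogeneous_eq)
  show "d \<in> End H \<and> gder_mat (mat_of d) \<and> compatible_relations (mat_of d)"
    if "d \<in> {d. \<exists>\<delta> d''. hom_qder_pair H \<delta> d d'' \<and> hom_compatible H \<delta> d}" for d
    using that hom_compatible_iff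
    by (auto simp: hom_qder_pair_eq hom_gder_triple_iff End_part_iff intro: gder_mat_if_relations)
qed (use hom_qder_pair_hom_part compatible_hom_part subspace_compatible_gder_mat in blast)+

lemma GDer_omega_eq:
  "GDer_omega H = {d \<in> End H. gder_mat (mat_of d) \<and> compatible_relations (mat_of d)}"
  unfolding GDer_omega_def
proof (rule span_homogeneous_eq)
  show "d \<in> End H \<and> gder_mat (mat_of d) \<and> compatible_relations (mat_of d)"
    if "d \<in> {d. \<exists>\<delta> d' d''. hom_gder_triple H \<delta> d d' d'' \<and> hom_compatible H \<delta> d}" for d
    using that hom_compatible_iff
    by (auto simp: hom_gder_triple_iff End_part_iff intro: gder_mat_if_relations)
qed (use hom_qder_pair_hom_part compatible_hom_part subspace_compatible_gder_mat
    hom_qder_pair_eq in blast)+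

section \<open>Dimensions\<close>

text \<open>\<open>I\<close> lists the positions of the free parameters, and the entries at these
  positions are coordinates dual to the matrices \<open>B p\<close>. Entries that depend linearly on
  the parameters are accounted for inside \<open>B p\<close>.\<close>

lemma End_dim_eq_card:
  assumes fin: "finite I"
    and B: "\<And>p. p \<in> I \<Longrightarrow> P (B p)"
    and gen: "\<And>A i j. P A \<Longrightarrow> A $ i $ j = (\<Sum>p\<in>I. A $ fst p $ snd p * B p $ i $ j)"
    and dual: "\<And>p q. p \<in> I \<Longrightarrow> q \<in> I \<Longrightarrow> B p $ fst q $ snd q = (if p = q then 1 else 0)"
  shows "End_dim H {d \<in> End H. P (mat_of d)} = card I"
proof -
  let ?b = "map_of_mat \<circ> B"
  have End_sum: "(\<Sum>p\<in>J. End_scl H (c p) (?b p)) \<in> End H"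
    and mat_sum: "mat_of (\<Sum>p\<in>J. End_scl H (c p) (?b p)) $ i $ j = (\<Sum>p\<in>J. c p * B p $ i $ j)"
    if "finite J" for J c i j
    using that by (induction J) (simp_all add: End_subspace_closed mat_of_scl)
  show ?thesis
    unfolding End_dim_def
  proof (rule E.dim_eq_card_family[where b = ?b])
    fix d assume d: "d \<in> {d \<in> End H. P (mat_of d)}"
    have "d = (\<Sum>p\<in>I. End_scl H (mat_of d $ fst p $ snd p) (?b p))"
    proof (rule End_eqI)
      show "mat_of d = mat_of (\<Sum>p\<in>I. End_scl H (mat_of d $ fst p $ snd p) (?b p))"
        unfolding vec_eq_iff mat_sum[OF fin] using d gen by blast
    qed (use d End_sum[OF fin] in auto)
    then show "\<exists>c. d = (\<Sum>p\<in>I. End_scl H (c p) (?b p))"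
      by (intro exI[where x = "\<lambda>p. mat_of d $ fst p $ snd p"])
  next
    fix c q assume "(\<Sum>p\<in>I. End_scl H (c p) (?b p)) = 0" and q: "q \<in> I"
    then have "(\<Sum>p\<in>I. c p * B p $ fst q $ snd q) = 0"
      using mat_sum[OF fin, of c "fst q" "snd q"] by simp
    \<comment> \<open>Reading the entry at position \<open>q\<close> of a vanishing combination
      isolates the coefficient \<open>c q\<close>.\<close>
    also have "(\<Sum>p\<in>I. c p * B p $ fst q $ snd q) = (\<Sum>p\<in>I. if p = q then c p else 0)"
      using q by (intro sum.cong) (simp_all add: dual)
    finally show "c q = 0" using fin q by simp
  qed (simp_all add: fin B)
qed

lemma End_dim_GDer: "End_dim H (GDer H) = 7"
proof -
  \<comment> \<open>All positions except (1, 2) and (1, 3), with matrix units as basis.\<close>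
  let ?I = "{(1, 1), (2, 1), (2, 2), (2, 3), (3, 1), (3, 2), (3, 3)} :: (3 \<times> 3) set"
  let ?B = "\<lambda>p::3 \<times> 3. (\<chi> i j. if p = (i, j) then 1 else 0) :: complex ^ 3 ^ 3"
  have "End_dim H (GDer H) = card ?I"
    unfolding GDer_eq
  proof (rule End_dim_eq_card[where B = ?B])
    fix A :: "complex ^ 3 ^ 3" and i j assume "gder_mat A"
    then show "A $ i $ j = (\<Sum>p\<in>?I. A $ fst p $ snd p * ?B p $ i $ j)"
      using exhaust_3[of i] exhaust_3[of j] by (auto simp: gder_mat_def)
  qed (auto simp: gder_mat_def)
  then show ?thesis by simp
qed

lemma End_dim_GDer_omega: "End_dim H (GDer_omega H) = 5"
proof -
  let ?I = "{(1, 1), (2, 1), (3, 1), (3, 2), (3, 3)} :: (3 \<times> 3) set"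
  \<comment> \<open>Position (2, 2) is absent from \<open>?I\<close> because compatibility ties it
    to (1, 1): the basis matrix for (1, 1) is diagonal with entries 1, -1, 0. The others are matrix
    units.\<close>
  let ?B = "\<lambda>p::3 \<times> 3. (\<chi> i j. if p = (i, j) then 1
    else if p = (1, 1) \<and> i = 2 \<and> j = 2 then - 1 else 0) :: complex ^ 3 ^ 3"
  have "End_dim H (GDer_omega H) = card ?I"
    unfolding GDer_omega_eq
  proof (rule End_dim_eq_card[where B = ?B])
    fix A :: "complex ^ 3 ^ 3" and i j assume "gder_mat A \<and> compatible_relations A"
    then show "A $ i $ j = (\<Sum>p\<in>?I. A $ fst p $ snd p * ?B p $ i $ j)"
      using exhaust_3[of i] exhaust_3[of j] by (auto simp: gder_mat_def compatible_relations_def)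
  qed (auto simp: gder_mat_def compatible_relations_def)
  then show ?thesis by simp
qed

lemma QDer_eq_GDer: "QDer H = GDer H"
  by (simp add: QDer_eq GDer_eq)

lemma QDer_omega_eq_GDer_omega: "QDer_omega H = GDer_omega H"
  by (simp add: QDer_omega_eq GDer_omega_eq)

lemma GDer_neq_End: "GDer H \<noteq> End H"
proof
  assume "GDer H = End H"
  then have "gder_mat (mat_of (map_of_mat (\<chi> i j. 1)))"
    using GDer_eq map_of_mat_End by blast
  then show False by (simp add: gder_mat_def)
qed

end

theorem mainTheorem4:
  fixes H :: "('a::ab_group_add) graded_bracket_space"
    and x1 x2 y :: 'a
    and M :: "('a \<Rightarrow> 'a) \<Rightarrow> complex ^ 3 ^ 3"
  assumes H: "is_H H x1 x2 y"
    and M: "M = matrix_of H (vector [x1, x2, y])"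
  shows
    "(GDer H = {d \<in> End H. \<exists>a11 a21 a22 a33 b23 b31 b32.
        M d = vector [vector [a11, 0, 0],
                      vector [a21, a22, b23],
                      vector [b31, b32, a33]]}
     \<and> (\<forall>d d' d''. d \<in> GDer H \<and> gder_assoc H d d' d'' \<longleftrightarrow>
          d \<in> End H \<and> d' \<in> End H \<and> d'' \<in> End H \<and>
          (\<exists>a11 a21 a22 a33 b23 b31 b32 a11' a12'' a22'' b32''.
             M d = vector [vector [a11, 0, 0],
                           vector [a21, a22, b23],
                           vector [b31, b32, a33]] \<and>
             M d' = vector [vector [a11', 0, 0],
                            vector [a21, a22 - a11 + a11', b23],
                            vector [b31, b32, a33 - a11 + a11']] \<and>
             M d'' = vector [vector [a22 + a11', a12'', b23],
                             vector [0, a22'', 0],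
                             vector [b32, b32'', a11' + a33]]))
     \<and> End_dim H (GDer H) = 7
     \<and> GDer H \<noteq> End H)
     \<and>
     (GDer_omega H = {d \<in> End H. \<exists>a11 a21 a33 b31 b32.
        M d = vector [vector [a11, 0, 0],
                      vector [a21, - a11, 0],
                      vector [b31, b32, a33]]}
     \<and> (\<forall>d d' d''. d \<in> GDer_omega H \<and> gder_assoc H d d' d'' \<longleftrightarrow>
          d \<in> End H \<and> d' \<in> End H \<and> d'' \<in> End H \<and>
          (\<exists>a11 a21 a33 b31 b32 a11' a12'' a22'' b32''.
             M d = vector [vector [a11, 0, 0],
                           vector [a21, - a11, 0],
                           vector [b31, b32, a33]] \<and>
             M d' = vector [vector [a11', 0, 0],
                            vector [a21, - 2 * a11 + a11', 0],
                            vector [b31, b32, a33 - a11 + a11']] \<and>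
             M d'' = vector [vector [- a11 + a11', a12'', 0],
                             vector [0, a22'', 0],
                             vector [b32, b32'', a11' + a33]]))
     \<and> End_dim H (GDer_omega H) = 5
     \<and> GDer_omega H \<noteq> GDer H)
     \<and>
     (QDer H = {d \<in> End H. \<exists>a11 a21 a22 a33 b23 b31 b32.
        M d = vector [vector [a11, 0, 0],
                      vector [a21, a22, b23],
                      vector [b31, b32, a33]]}
     \<and> (\<forall>d d''. d \<in> QDer H \<and> qder_assoc H d d'' \<longleftrightarrow>
          d \<in> End H \<and> d'' \<in> End H \<and>
          (\<exists>a11 a21 a22 a33 b23 b31 b32 a12'' a22'' b32''.
             M d = vector [vector [a11, 0, 0],
                           vector [a21, a22, b23],
                           vector [b31, b32, a33]] \<and>
             M d'' = vector [vector [a11 + a22, a12'', b23],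
                             vector [0, a22'', 0],
                             vector [b32, b32'', a11 + a33]]))
     \<and> End_dim H (QDer H) = 7
     \<and> QDer H = GDer H)
     \<and>
     (QDer_omega H = {d \<in> End H. \<exists>a11 a21 a33 b31 b32.
        M d = vector [vector [a11, 0, 0],
                      vector [a21, - a11, 0],
                      vector [b31, b32, a33]]}
     \<and> (\<forall>d d''. d \<in> QDer_omega H \<and> qder_assoc H d d'' \<longleftrightarrow>
          d \<in> End H \<and> d'' \<in> End H \<and>
          (\<exists>a11 a21 a33 b31 b32 a12'' a22'' b32''.
             M d = vector [vector [a11, 0, 0],
                           vector [a21, - a11, 0],
                           vector [b31, b32, a33]] \<and>
             M d'' = vector [vector [0, a12'', 0],
                             vector [0, a22'', 0],
                             vector [b32, b32'', a11 + a33]]))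
     \<and> End_dim H (QDer_omega H) = 5
     \<and> QDer_omega H \<noteq> QDer H
     \<and> QDer_omega H = GDer_omega H)"
proof -
  interpret omega_H H x1 x2 y by unfold_locales (rule H)
  have M: "M = mat_of" using M by (simp add: mat_of_def)
  have ne: "GDer_omega H \<noteq> GDer H"
    using End_dim_GDer End_dim_GDer_omega by auto
  \<comment> \<open>The identities of spaces and of associated maps reduce parts (3) and (4) to the
    case \<open>d' = d\<close> of (1) and (2). In the compatible cases, a22 = -a11 gives the entry
    -2 a11 + a11' of \<open>d'\<close> and the entry -a11 + a11' of \<open>d''\<close>; the latter
    is 0 when \<open>d' = d\<close>.\<close>
  show ?thesis
    unfolding M QDer_eq_GDer QDer_omega_eq_GDer_omega qder_assoc_iff gder_assoc_iff
      End_dim_GDer End_dim_GDer_omega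
    using ne GDer_neq_End
    by (auto simp: GDer_eq GDer_omega_eq matrix_3_eq_iff gder_mat_def compatible_relations_def
        gder_relations_def)
qed

end
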